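(* In the weighted graph setting described in the context, let $I$ be the $|\partial\Omega|\times|\partial\Omega|$ identity matrix. Then the following jump relations hold: $$\gamma_1^\pm\mathcal S=\mp\tfrac{I}{2}+D',\qquad \gamma_0\mathcal D^\pm=\mp\tfrac{I}{2}+D,\qquad \gamma_1^+\mathcal D^-=\gamma_1^-\mathcal D^+ .$$
   Context: Graph. $\mathcal G=(\mathcal V,\mathcal E)$ is a finite connected undirected graph without self-edges. $\mathcal V$ is partitioned into four nonempty disjoint sets $B,\Omega^+,\partial\Omega,\Omega^-$ such that, among pairs of distinct sets of the partition, the only ones joined by at least one edge are $\{B,\Omega^+\}$, $\{\Omega^+,\partial\Omega\}$, $\{\partial\Omega,\Omega^-\}$ (so there are no edges between $B$ and $\partial\Omega$, $B$ and $\Omega^-$, or $\Omega^+$ and $\Omega^-$). Put $\mathcal V^\circ=\mathcal V\setminus B$. Laplacian. The discrete gradient $\nabla$ is the $|\mathcal E|\times|\mathcal V|$ matrix with $(\nabla u)_k=u_i-u_j$, where $i,j$ are the endpoints of edge $k$ in a fixed order. For $s\in[0,\infty)^{|\mathcal E|}$, $L(s)=\nabla^T\mathrm{diag}(s)\nabla$. A conductivity $\sigma\in(0,\infty)^{|\mathcal E|}$ is fixed. $L[X,Y]$ denotes the submatrix with rows $X$, columns $Y$; $R_X$ is the $|X|\times|\mathcal V|$ matrix with $R_Xu=u|_X$. Green function. $G=R_{\mathcal V^\circ}^T\,L(\sigma)[\mathcal V^\circ,\mathcal V^\circ]^{-1}R_{\mathcal V^\circ}$ (the inverse exists since $\mathcal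 G$ is connected). Edge partition of unity. Let $\mathcal E^+$ be the edges with at least one node in $B\cup\Omega^+$ and $\mathcal E^-$ the edges with at least one node in $\Omega^-$. Fix any $p^+,p^-\in[0,1]^{|\mathcal E|}$ with $p^++p^-=1$, $p^+|_{\mathcal E^+}=1$, $p^-|_{\mathcal E^-}=1$. Set $\sigma^\pm=p^\pm\sigma$ (componentwise), so $L(\sigma)=L(\sigma^+)+L(\sigma^-)$. Traces and potentials. $\gamma_0=R_{\partial\Omega}$, $\gamma_1^\pm=\mp R_{\partial\Omega}L(\sigma^\pm)$, $\mathcal S=G\gamma_0^T$, $\mathcal D^\pm=G[\gamma_1^\pm]^T$. Boundary layer operators ($|\partial\Omega|\times|\partial\Omega|$ matrices). $D=\frac12\gamma_0(\mathcal D^++\mathcal D^-)$ and $D'=\frac12(\gamma_1^++\gamma_1^-)\mathcal S=D^T$. *)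

theory Defs
  imports
    "Jordan_Normal_Form.Matrix"
    "Jordan_Normal_Form.DL_Submatrix"
    "Jordan_Normal_Form.Gauss_Jordan_Elimination"
begin

(* The vertices are numbered 0, ..., n_verts - 1 and the edges 0, ..., |E| - 1, so that vectors and
   matrices indexed by vertices or edges are those of Jordan_Normal_Form.  An edge is the set of its
   two endpoints; ends lists the edges and fixes the order of the endpoints of each.  Rows and
   columns indexed by a set X of vertices are listed by increasing vertex: row i belongs to the
   vertex pick X i. *)
record network =
  n_verts :: nat
  edges :: "nat set set"
  ends :: "nat \<Rightarrow> nat \<times> nat"
  B :: "nat set"
  Omega_plus :: "nat set"
  bd_Omega :: "nat set"
  Omega_minus :: "nat set"
  sigma :: "real vec"
  p_plus :: "real vec"
  p_minus :: "real vec"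

definition verts :: "network \<Rightarrow> nat set" where
  "verts N = {0..<n_verts N}"

definition n_edges :: "network \<Rightarrow> nat" where
  "n_edges N = card (edges N)"

definition edge :: "network \<Rightarrow> nat \<Rightarrow> nat set" where
  "edge N k = {fst (ends N k), snd (ends N k)}"

definition simple_graph :: "network \<Rightarrow> bool" where
  "simple_graph N \<longleftrightarrow>
     edges N \<subseteq> {{i, j} |i j. i \<in> verts N \<and> j \<in> verts N \<and> i \<noteq> j} \<and>
     bij_betw (edge N) {0..<n_edges N} (edges N)"

definition connected_graph :: "network \<Rightarrow> bool" where
  "connected_graph N \<longleftrightarrow>
     (\<forall>i\<in>verts N. \<forall>j\<in>verts N. (i, j) \<in> {(x, y). {x, y} \<in> edges N}\<^sup>*)"

definition joined :: "network \<Rightarrow> nat set \<Rightarrow> nat set \<Rightarrow> bool" where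
  "joined N X Y \<longleftrightarrow> (\<exists>x\<in>X. \<exists>y\<in>Y. {x, y} \<in> edges N)"

definition layered :: "network \<Rightarrow> bool" where
  "layered N \<longleftrightarrow>
     B N \<union> Omega_plus N \<union> bd_Omega N \<union> Omega_minus N = verts N \<and>
     B N \<noteq> {} \<and> Omega_plus N \<noteq> {} \<and> bd_Omega N \<noteq> {} \<and> Omega_minus N \<noteq> {} \<and>
     B N \<inter> Omega_plus N = {} \<and> B N \<inter> bd_Omega N = {} \<and> B N \<inter> Omega_minus N = {} \<and>
     Omega_plus N \<inter> bd_Omega N = {} \<and> Omega_plus N \<inter> Omega_minus N = {} \<and>
     bd_Omega N \<inter> Omega_minus N = {} \<and>
     joined N (B N) (Omega_plus N) \<and> joined N (Omega_plus N) (bd_Omega N) \<and>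
     joined N (bd_Omega N) (Omega_minus N) \<and>
     \<not> joined N (B N) (bd_Omega N) \<and> \<not> joined N (B N) (Omega_minus N) \<and>
     \<not> joined N (Omega_plus N) (Omega_minus N)"

definition conductivity :: "network \<Rightarrow> bool" where
  "conductivity N \<longleftrightarrow>
     sigma N \<in> carrier_vec (n_edges N) \<and> (\<forall>k<n_edges N. 0 < sigma N $ k)"

definition edge_partition_of_unity :: "network \<Rightarrow> bool" where
  "edge_partition_of_unity N \<longleftrightarrow>
     p_plus N \<in> carrier_vec (n_edges N) \<and> p_minus N \<in> carrier_vec (n_edges N) \<and>
     (\<forall>k<n_edges N. p_plus N $ k \<in> {0..1} \<and> p_minus N $ k \<in> {0..1} \<and>
        p_plus N $ k + p_minus N $ k = 1 \<and>
        (edge N k \<inter> (B N \<union> Omega_plus N) \<noteq> {} \<longrightarrow> p_plus N $ k = 1) \<and>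
        (edge N k \<inter> Omega_minus N \<noteq> {} \<longrightarrow> p_minus N $ k = 1))"

definition grad :: "network \<Rightarrow> real mat" where
  "grad N = mat (n_edges N) (n_verts N)
     (\<lambda>(k, v). of_bool (v = fst (ends N k)) - of_bool (v = snd (ends N k)))"

lemma grad_mult_vec:
  assumes "simple_graph N" "u \<in> carrier_vec (n_verts N)" "k < n_edges N"
  shows "(grad N *\<^sub>v u) $ k = u $ fst (ends N k) - u $ snd (ends N k)"
proof -
  have "edge N k \<in> edges N"
    using assms(1,3) unfolding simple_graph_def bij_betw_def by auto
  then obtain i j where "edge N k = {i, j}" "i < n_verts N" "j < n_verts N"
    using assms(1) unfolding simple_graph_def verts_def by fastforce
  then have "fst (ends N k) < n_verts N" "snd (ends N k) < n_verts N"
    unfolding edge_def by (auto simp: doubleton_eq_iff)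
  then show ?thesis
    using assms(2,3)
    by (simp add: grad_def scalar_prod_def left_diff_distrib sum_subtractf of_bool_def
        if_distrib[of "\<lambda>c. c * _"] cong: if_cong)
qed

definition Lap :: "network \<Rightarrow> real vec \<Rightarrow> real mat" where
  "Lap N s = transpose_mat (grad N) * mat_diag (n_edges N) (\<lambda>k. s $ k) * grad N"

definition Res :: "network \<Rightarrow> nat set \<Rightarrow> real mat" where
  "Res N X = mat (card X) (n_verts N) (\<lambda>(i, v). of_bool (v = pick X i))"

lemma Res_mult_vec:
  assumes "X \<subseteq> verts N" "u \<in> carrier_vec (n_verts N)"
  shows "Res N X *\<^sub>v u = vec (card X) (\<lambda>i. u $ pick X i)"
proof (rule eq_vecI)
  fix i assume "i < dim_vec (vec (card X) (\<lambda>i. u $ pick X i))"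
  then have i: "i < card X" by simp
  then have "pick X i < n_verts N"
    using assms(1) pick_in_set_le[of i X] by (auto simp: verts_def)
  then show "(Res N X *\<^sub>v u) $ i = vec (card X) (\<lambda>i. u $ pick X i) $ i"
    using i assms(2)
    by (simp add: Res_def scalar_prod_def of_bool_def if_distrib[of "\<lambda>c. c * _"] cong: if_cong)
qed (simp add: Res_def)

definition interior_verts :: "network \<Rightarrow> nat set" where
  "interior_verts N = verts N - B N"

definition Green :: "network \<Rightarrow> real mat" where
  "Green N =
     transpose_mat (Res N (interior_verts N)) *
     the (mat_inverse (submatrix (Lap N (sigma N)) (interior_verts N) (interior_verts N))) *
     Res N (interior_verts N)"

definition sigma_plus :: "network \<Rightarrow> real vec" where
  "sigma_plus N = vec (n_edges N) (\<lambda>k. p_plus N $ k * sigma N $ k)"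

definition sigma_minus :: "network \<Rightarrow> real vec" where
  "sigma_minus N = vec (n_edges N) (\<lambda>k. p_minus N $ k * sigma N $ k)"

definition gamma0 :: "network \<Rightarrow> real mat" where
  "gamma0 N = Res N (bd_Omega N)"

definition gamma1_plus :: "network \<Rightarrow> real mat" where
  "gamma1_plus N = - (Res N (bd_Omega N) * Lap N (sigma_plus N))"

definition gamma1_minus :: "network \<Rightarrow> real mat" where
  "gamma1_minus N = Res N (bd_Omega N) * Lap N (sigma_minus N)"

definition single_layer :: "network \<Rightarrow> real mat" where
  "single_layer N = Green N * transpose_mat (gamma0 N)"

definition double_layer_plus :: "network \<Rightarrow> real mat" where
  "double_layer_plus N = Green N * transpose_mat (gamma1_plus N)"

definition double_layer_minus :: "network \<Rightarrow> real mat" where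
  "double_layer_minus N = Green N * transpose_mat (gamma1_minus N)"

definition D_op :: "network \<Rightarrow> real mat" where
  "D_op N = (1/2) \<cdot>\<^sub>m (gamma0 N * (double_layer_plus N + double_layer_minus N))"

definition D'_op :: "network \<Rightarrow> real mat" where
  "D'_op N = (1/2) \<cdot>\<^sub>m ((gamma1_plus N + gamma1_minus N) * single_layer N)"

definition Id_bd :: "network \<Rightarrow> real mat" where
  "Id_bd N = 1\<^sub>m (card (bd_Omega N))"

end

theory Submission
  imports Defs "Jordan_Normal_Form.Determinant"
begin

text \<open>
  Write \<open>Q\<close> for the restriction to the interior vertices and \<open>R = R Q\<^sup>T Q\<close> for that to the
  boundary. The matrix \<open>Q L Q\<^sup>T\<close> is invertible: a vector in its kernel has zero energy, hence is
  constant on the connected graph, and vanishes on the nonempty set \<open>B\<close>. So \<open>R L G = R\<close> and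
  \<open>G L R\<^sup>T = R\<^sup>T\<close>. All jump relations follow from these two identities and
  \<open>L = L\<^sup>+ + L\<^sup>-\<close>; in particular \<open>R L\<^sup>+ G L\<^sup>- R\<^sup>T\<close> and \<open>R L\<^sup>- G L\<^sup>+ R\<^sup>T\<close> both equal
  \<open>R L\<^sup>- R\<^sup>T - R L\<^sup>- G L\<^sup>- R\<^sup>T\<close>.
\<close>

section \<open>Matrix algebra independent of the graph\<close>

text \<open>Every dimension in the premises is read off from the matrices themselves, so the
  simplifier can use this as a conditional rewrite rule; with carrier premises it would have to
  guess the dimensions.\<close>

lemma assoc_mult_mat_dim:
  "dim_col A = dim_row B \<Longrightarrow> dim_col B = dim_row C \<Longrightarrow> A * B * C = A * (B * C)"
  for A B C :: "'a :: semiring_0 mat"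
  by (rule assoc_mult_mat[of A "dim_row A" "dim_row B" B "dim_row C" C "dim_col C"]) auto

text \<open>By \<open>RQ\<close> the projection \<open>Q\<^sup>T * Q\<close> may be inserted next to
  \<open>R\<close>; this completes the block \<open>Q * L * Q\<^sup>T\<close> beside
  \<open>C\<close>, where the two cancel. The second identity inserts it next to
  \<open>R\<^sup>T\<close> and cancels from the other side.\<close>

lemma compressed_inverse_mult:
  fixes L :: "'a :: comm_semiring_1 mat"
  assumes R: "R \<in> carrier_mat m n" and Q: "Q \<in> carrier_mat k n" and L: "L \<in> carrier_mat n n"
    and C: "C \<in> carrier_mat k k"
    and inv: "(Q * L * Q\<^sup>T) * C = 1\<^sub>m k" "C * (Q * L * Q\<^sup>T) = 1\<^sub>m k"
    and RQ: "R * (Q\<^sup>T * Q) = R"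
  shows "R * (L * (Q\<^sup>T * C * Q)) = R" "(Q\<^sup>T * C * Q) * (L * R\<^sup>T) = R\<^sup>T"
proof -
  have d [simp]: "dim_row R = m" "dim_col R = n" "dim_row Q = k" "dim_col Q = n"
    "dim_row L = n" "dim_col L = n" "dim_row C = k" "dim_col C = k"
    using assms by auto
  have RT: "Q\<^sup>T * (Q * R\<^sup>T) = R\<^sup>T"
  proof -
    have "(R * (Q\<^sup>T * Q))\<^sup>T = Q\<^sup>T * Q * R\<^sup>T"
      using Q by (simp add: transpose_mult[OF R, of "Q\<^sup>T * Q" n] transpose_mult[of "Q\<^sup>T" n k Q n])
    then show ?thesis by (simp add: RQ assoc_mult_mat_dim)
  qed
  have "R * (L * (Q\<^sup>T * C * Q)) = R * (Q\<^sup>T * Q) * (L * (Q\<^sup>T * C * Q))"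
    by (simp add: RQ)
  also have "\<dots> = R * (Q\<^sup>T * ((Q * L * Q\<^sup>T) * C * Q))"
    by (simp add: assoc_mult_mat_dim)
  also have "\<dots> = R"
    using Q by (simp add: inv RQ)
  finally show "R * (L * (Q\<^sup>T * C * Q)) = R" .
  have "(Q\<^sup>T * C * Q) * (L * R\<^sup>T) = (Q\<^sup>T * C * Q) * (L * (Q\<^sup>T * (Q * R\<^sup>T)))"
    by (simp add: RT)
  also have "\<dots> = Q\<^sup>T * ((C * (Q * L * Q\<^sup>T)) * (Q * R\<^sup>T))"
    by (simp add: assoc_mult_mat_dim)
  also have "\<dots> = R\<^sup>T"
    using Q R by (simp add: inv RT left_mult_one_mat[of _ k m])
  finally show "(Q\<^sup>T * C * Q) * (L * R\<^sup>T) = R\<^sup>T" .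
qed

text \<open>A trivial kernel forces a nonzero determinant, so the result of
  \<open>mat_inverse\<close> is not \<open>None\<close>. This gives the \<open>the\<close> in
  \<open>Green\<close> its intended meaning.\<close>

lemma mat_inverse_of_trivial_kernel:
  fixes A :: "'a :: field mat"
  assumes A: "A \<in> carrier_mat n n"
    and ker: "\<And>x. x \<in> carrier_vec n \<Longrightarrow> A *\<^sub>v x = 0\<^sub>v n \<Longrightarrow> x = 0\<^sub>v n"
  shows "A * the (mat_inverse A) = 1\<^sub>m n" "the (mat_inverse A) * A = 1\<^sub>m n"
    "the (mat_inverse A) \<in> carrier_mat n n"
proof -
  have "det A \<noteq> 0"
    using ker det_0_iff_vec_prod_zero[OF A] by blast
  then have "A \<in> Units (ring_mat TYPE('a) n ())"
    by (rule det_non_zero_imp_unit[OF A])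
  then obtain C where "mat_inverse A = Some C"
    using mat_inverse(1)[OF A, where b = "()"] by (cases "mat_inverse A") auto
  with mat_inverse(2)[OF A this] show "A * the (mat_inverse A) = 1\<^sub>m n"
    "the (mat_inverse A) * A = 1\<^sub>m n" "the (mat_inverse A) \<in> carrier_mat n n"
    by auto
qed

text \<open>Two values are their mean minus and plus half of their difference. Since
  \<open>D_op\<close> and \<open>D'_op\<close> are means of one-sided traces, each pair of jump
  relations reduces to computing one difference.\<close>

lemma eq_mean_of_jump:
  fixes a b :: "real mat"
  assumes "a \<in> carrier_mat m m" "b \<in> carrier_mat m m" "b - a = 1\<^sub>m m"
  shows "a = - ((1/2) \<cdot>\<^sub>m 1\<^sub>m m) + (1/2) \<cdot>\<^sub>m (a + b)"
    and "b = (1/2) \<cdot>\<^sub>m 1\<^sub>m m + (1/2) \<cdot>\<^sub>m (a + b)"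
  unfolding assms(3)[symmetric] using assms(1,2) by (auto simp: field_simps)

text \<open>Adding \<open>?Z\<close> to either side yields \<open>R * M * R\<^sup>T\<close>: on the
  left side \<open>P + M\<close> cancels against \<open>G\<close> by \<open>left\<close>, on the
  right side by \<open>right\<close>.\<close>

lemma commuted_layer_products:
  fixes P M :: "'a :: comm_ring_1 mat"
  assumes R: "R \<in> carrier_mat m n" and P: "P \<in> carrier_mat n n" and M: "M \<in> carrier_mat n n"
    and G: "G \<in> carrier_mat n n"
    and left: "R * ((P + M) * G) = R" and right: "G * ((P + M) * R\<^sup>T) = R\<^sup>T"
  shows "(R * P) * (G * (M * R\<^sup>T)) = (R * M) * (G * (P * R\<^sup>T))"
proof -
  have d [simp]: "dim_row R = m" "dim_col R = n" "dim_row P = n" "dim_col P = n"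
    "dim_row M = n" "dim_col M = n" "dim_row G = n" "dim_col G = n"
    using assms by auto
  have RT: "R\<^sup>T \<in> carrier_mat n m" using R by simp
  note c = mult_carrier_mat[OF R P] mult_carrier_mat[OF R M] mult_carrier_mat[OF M RT]
    mult_carrier_mat[OF P RT]
  note c' = mult_carrier_mat[OF G c(3)] mult_carrier_mat[OF G c(4)]
  let ?Z = "(R * M) * (G * (M * R\<^sup>T))"
  have "(R * P) * (G * (M * R\<^sup>T)) + ?Z = (R * P + R * M) * (G * (M * R\<^sup>T))"
    by (rule add_mult_distrib_mat[OF c(1,2) c'(1), symmetric])
  also have "\<dots> = (R * (P + M)) * (G * (M * R\<^sup>T))"
    by (simp add: mult_add_distrib_mat[OF R P M])
  also have "\<dots> = (R * ((P + M) * G)) * (M * R\<^sup>T)"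
    by (simp add: assoc_mult_mat_dim)
  also have "\<dots> = R * M * R\<^sup>T"
    by (simp add: left assoc_mult_mat_dim)
  also have "\<dots> = (R * M) * (G * ((P + M) * R\<^sup>T))"
    by (simp add: right)
  also have "\<dots> = (R * M) * (G * (P * R\<^sup>T) + G * (M * R\<^sup>T))"
    by (simp add: add_mult_distrib_mat[OF P M RT] mult_add_distrib_mat[OF G c(4,3)])
  also have "\<dots> = (R * M) * (G * (P * R\<^sup>T)) + ?Z"
    by (rule mult_add_distrib_mat[OF c(2) c'(2,1)])
  finally have eq: "(R * P) * (G * (M * R\<^sup>T)) + ?Z = (R * M) * (G * (P * R\<^sup>T)) + ?Z" .
  \<comment> \<open>A matrix sum takes its dimensions from the second summand, so cancellation is
    not valid on the whole matrix type; \<open>?Z\<close> is cancelled entry by entry, with the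
    dimensions checked separately.\<close>
  show ?thesis
  proof (rule eq_matI)
    fix i j assume "i < dim_row ((R * M) * (G * (P * R\<^sup>T)))" "j < dim_col ((R * M) * (G * (P * R\<^sup>T)))"
    then have "(X + ?Z) $$ (i, j) = X $$ (i, j) + ?Z $$ (i, j)" for X
      by (intro index_add_mat) auto
    then show "((R * P) * (G * (M * R\<^sup>T))) $$ (i, j) = ((R * M) * (G * (P * R\<^sup>T))) $$ (i, j)"
      using arg_cong[OF eq, of "\<lambda>X. X $$ (i, j)"] by (metis add_right_cancel)
  qed auto
qed

section \<open>Restriction matrices\<close>

text \<open>Strict monotonicity gives injectivity, and counting gives surjectivity. It serves to
  turn sums over row numbers into sums over vertices.\<close>

lemma bij_betw_pick:
  assumes "finite X"
  shows "bij_betw (pick X) {0..<card X} X"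
proof -
  have "inj_on (pick X) {0..<card X}"
    by (rule linorder_inj_onI) (auto dest: pick_mono_le[of _ X])
  moreover have "pick X ` {0..<card X} \<subseteq> X"
    by (auto intro: pick_in_set_le)
  ultimately show ?thesis
    using assms by (simp add: bij_betw_def card_image card_subset_eq)
qed

lemma Res_carrier [simp]: "Res N X \<in> carrier_mat (card X) (n_verts N)"
  by (simp add: Res_def)

lemma dim_Res [simp]: "dim_row (Res N X) = card X" "dim_col (Res N X) = n_verts N"
  by (simp_all add: Res_def)

lemma pick_less:
  "X \<subseteq> verts N \<Longrightarrow> i < card X \<Longrightarrow> pick X i < n_verts N"
  using pick_in_set_le[of i X] by (auto simp: verts_def)

lemma finite_subset_verts: "X \<subseteq> verts N \<Longrightarrow> finite X"
  by (rule finite_subset) (auto simp: verts_def)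

lemma Res_transpose_Res:
  assumes "X \<subseteq> verts N"
  shows "(Res N X)\<^sup>T * Res N X = mat_diag (n_verts N) (\<lambda>v. of_bool (v \<in> X))"
proof (rule eq_matI)
  fix v w assume "v < dim_row (mat_diag (n_verts N) (\<lambda>v. of_bool (v \<in> X) :: real))"
    "w < dim_col (mat_diag (n_verts N) (\<lambda>v. of_bool (v \<in> X) :: real))"
  then have vw: "v < n_verts N" "w < n_verts N" by (auto simp: mat_diag_def)
  have "((Res N X)\<^sup>T * Res N X) $$ (v, w)
      = (\<Sum>i = 0..<card X. of_bool (v = pick X i) * of_bool (w = pick X i))"
    using vw by (simp add: Res_def scalar_prod_def)
  also have "\<dots> = (\<Sum>x\<in>X. of_bool (v = x) * of_bool (w = x))"
    using bij_betw_pick[OF finite_subset_verts[OF assms]] by (rule sum.reindex_bij_betw)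
  also have "\<dots> = (\<Sum>x\<in>X. if v = x then of_bool (v = w) else 0)"
    by (rule sum.cong) auto
  also have "\<dots> = of_bool (v \<in> X \<and> v = w)"
    using finite_subset_verts[OF assms] by simp
  finally show "((Res N X)\<^sup>T * Res N X) $$ (v, w)
      = mat_diag (n_verts N) (\<lambda>v. of_bool (v \<in> X)) $$ (v, w)"
    using vw by (simp add: mat_diag_def)
qed (auto simp: Res_def mat_diag_def)

lemma Res_Res_transpose:
  assumes "X \<subseteq> verts N"
  shows "Res N X * (Res N X)\<^sup>T = 1\<^sub>m (card X)"
proof (rule eq_matI)
  fix i j assume "i < dim_row (1\<^sub>m (card X) :: real mat)" "j < dim_col (1\<^sub>m (card X) :: real mat)"
  then have ij: "i < card X" "j < card X" by auto
  have "(pick X i = pick X j) = (i = j)"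
    using bij_betw_pick[OF finite_subset_verts[OF assms]] ij
    by (auto simp: bij_betw_def inj_on_eq_iff)
  then show "(Res N X * (Res N X)\<^sup>T) $$ (i, j) = 1\<^sub>m (card X) $$ (i, j)"
    using ij pick_less[OF assms]
    by (simp add: Res_def scalar_prod_def of_bool_def if_distrib[of "\<lambda>c. c * _"] cong: if_cong)
qed (auto simp: Res_def)

text \<open>Each row of \<open>Res N X\<close> is a unit vector at a vertex of \<open>Y\<close>,
  which the projection onto \<open>Y\<close> fixes. This supplies the premise \<open>RQ\<close> of
  \<open>compressed_inverse_mult\<close>.\<close>

lemma Res_mult_proj:
  assumes "X \<subseteq> Y" "Y \<subseteq> verts N"
  shows "Res N X * ((Res N Y)\<^sup>T * Res N Y) = Res N X"
  unfolding Res_transpose_Res[OF assms(2)] mat_diag_mult_right[OF Res_carrier]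
proof (rule eq_matI)
  fix i v assume iv: "i < dim_row (Res N X)" "v < dim_col (Res N X)"
  then have "i < card X" by (simp add: Res_def)
  then have "pick X i \<in> Y" using pick_in_set_le[of i X] assms(1) by blast
  then show "mat (card X) (n_verts N) (\<lambda>(i, j). Res N X $$ (i, j) * of_bool (j \<in> Y)) $$ (i, v)
      = Res N X $$ (i, v)"
    using iv by (auto simp: Res_def)
qed (auto simp: Res_def)

text \<open>Puts the block inverted in \<open>Green\<close> into the form
  \<open>Q * L * Q\<^sup>T\<close>: the left factor selects rows and the right factor selects
  columns.\<close>

lemma submatrix_eq_Res:
  assumes "X \<subseteq> verts N" and A: "A \<in> carrier_mat (n_verts N) (n_verts N)"
  shows "submatrix A X X = Res N X * A * (Res N X)\<^sup>T"
proof -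
  have X: "{i. i < n_verts N \<and> i \<in> X} = X"
    using assms(1) by (auto simp: verts_def)
  show ?thesis
  proof (rule eq_matI)
    fix i j assume "i < dim_row (Res N X * A * (Res N X)\<^sup>T)" "j < dim_col (Res N X * A * (Res N X)\<^sup>T)"
    then have ij: "i < card X" "j < card X" by (auto simp: Res_def)
    note p = pick_less[OF assms(1)]
    have "(Res N X * A) $$ (i, v) = A $$ (pick X i, v)" if "v < n_verts N" for v
      using that A ij p
      by (simp add: Res_def scalar_prod_def of_bool_def if_distrib[of "\<lambda>c. c * _"] cong: if_cong)
    then have "row (Res N X * A) i = row A (pick X i)"
      using A ij p by (intro eq_vecI) (auto simp: Res_def)
    then have "(Res N X * A * (Res N X)\<^sup>T) $$ (i, j) = A $$ (pick X i, pick X j)"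
      using A ij p
      by (simp add: Res_def scalar_prod_def of_bool_def if_distrib[of "\<lambda>c. _ * c"] cong: if_cong)
    then show "submatrix A X X $$ (i, j) = (Res N X * A * (Res N X)\<^sup>T) $$ (i, j)"
      using ij A by (simp add: submatrix_def X)
  qed (use A in \<open>auto simp: submatrix_def X Res_def\<close>)
qed

section \<open>The weighted Laplacian and its energy\<close>

lemma grad_carrier [simp]: "grad N \<in> carrier_mat (n_edges N) (n_verts N)"
  by (simp add: grad_def)

lemma Lap_carrier [simp]: "Lap N s \<in> carrier_mat (n_verts N) (n_verts N)"
  unfolding Lap_def by (intro mult_carrier_mat[of _ _ "n_edges N"]) auto

lemma Lap_eq: "Lap N s = (grad N)\<^sup>T * (mat_diag (n_edges N) (\<lambda>k. s $ k) * grad N)"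
  unfolding Lap_def by (rule assoc_mult_mat[of _ "n_verts N" "n_edges N" _ "n_edges N" _ "n_verts N"]) auto

lemma Lap_transpose: "(Lap N s)\<^sup>T = Lap N s"
proof -
  let ?d = "mat_diag (n_edges N) (\<lambda>k. s $ k)"
  have d: "?d \<in> carrier_mat (n_edges N) (n_edges N)" "?d\<^sup>T = ?d"
    by (auto simp: mat_diag_def)
  have gT: "(grad N)\<^sup>T \<in> carrier_mat (n_verts N) (n_edges N)" by simp
  show ?thesis
    by (subst (1) Lap_eq)
      (simp add: transpose_mult[OF gT mult_carrier_mat[OF d(1) grad_carrier]]
        transpose_mult[OF d(1) grad_carrier] d(2) Lap_def)
qed

lemma Lap_add:
  assumes "\<And>k. k < n_edges N \<Longrightarrow> s $ k + t $ k = r $ k"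
  shows "Lap N r = Lap N s + Lap N t"
proof -
  let ?d = "\<lambda>s. mat_diag (n_edges N) (\<lambda>k. s $ k) :: real mat"
  have d: "?d q \<in> carrier_mat (n_edges N) (n_edges N)" for q by simp
  have gT: "(grad N)\<^sup>T \<in> carrier_mat (n_verts N) (n_edges N)" by simp
  have "?d r = ?d s + ?d t"
    using assms by (auto simp: mat_diag_def)
  then show ?thesis
    unfolding Lap_eq
    by (simp only: add_mult_distrib_mat[OF d d grad_carrier]
        mult_add_distrib_mat[OF gT mult_carrier_mat[OF d grad_carrier] mult_carrier_mat[OF d grad_carrier]])
qed

text \<open>The Dirichlet energy, obtained by moving the transposed gradient to the other side of
  the scalar product.\<close>

lemma Lap_energy:
  assumes u: "u \<in> carrier_vec (n_verts N)"
  shows "u \<bullet> (Lap N s *\<^sub>v u) = (\<Sum>k = 0..<n_edges N. s $ k * ((grad N *\<^sub>v u) $ k)\<^sup>2)"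
proof -
  let ?d = "mat_diag (n_edges N) (\<lambda>k. s $ k)" and ?g = "grad N *\<^sub>v u"
  have g: "?g \<in> carrier_vec (n_edges N)" by (simp add: mult_mat_vec_carrier[OF grad_carrier u])
  have "?d *\<^sub>v g = vec (n_edges N) (\<lambda>k. s $ k * g $ k)"
    if "g \<in> carrier_vec (n_edges N)" for g
    using that by (intro eq_vecI)
      (auto simp: mat_diag_def scalar_prod_def if_distrib[of "\<lambda>c. c * _"] cong: if_cong)
  note d = this[OF g]
  have "Lap N s *\<^sub>v u = (grad N)\<^sup>T *\<^sub>v (?d *\<^sub>v ?g)"
    unfolding Lap_eq using u
    by (simp add: assoc_mult_mat_vec[OF _ mult_carrier_mat[OF mat_diag_dim grad_carrier], of _ "n_verts N"]
      assoc_mult_mat_vec[OF mat_diag_dim grad_carrier])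
  moreover have dc: "?d *\<^sub>v ?g \<in> carrier_vec (n_edges N)" by (simp add: d)
  ultimately have "u \<bullet> (Lap N s *\<^sub>v u) = (?d *\<^sub>v ?g) \<bullet> ?g"
    using transpose_vec_mult_scalar[OF grad_carrier u dc]
      comm_scalar_prod[of u "n_verts N" "(grad N)\<^sup>T *\<^sub>v (?d *\<^sub>v ?g)"] u
    by (simp add: mult_mat_vec_carrier[of "(grad N)\<^sup>T" "n_verts N" "n_edges N"])
  moreover have "vec (n_edges N) (\<lambda>k. s $ k * g $ k) \<bullet> g = (\<Sum>k = 0..<n_edges N. s $ k * (g $ k)\<^sup>2)"
    if "g \<in> carrier_vec (n_edges N)" for g
    using that by (simp add: scalar_prod_def power2_eq_square mult.assoc)
  ultimately show ?thesis
    using g by (simp only: d)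
qed

text \<open>The energy is a sum of nonnegative terms with positive weights, so the gradient vanishes
  on every edge; equality of values then spreads along a path from \<open>i\<close> to
  \<open>j\<close>.\<close>

lemma Lap_energy_zero_imp_constant:
  assumes graph: "simple_graph N" "connected_graph N" and "conductivity N"
    and u: "u \<in> carrier_vec (n_verts N)" and zero: "u \<bullet> (Lap N (sigma N) *\<^sub>v u) = 0"
    and "i \<in> verts N" "j \<in> verts N"
  shows "u $ i = u $ j"
proof -
  have pos: "0 < sigma N $ k" if "k < n_edges N" for k
    using assms(3) that by (simp add: conductivity_def)
  have "(grad N *\<^sub>v u) $ k = 0" if "k < n_edges N" for k
  proof -
    have "sigma N $ k * ((grad N *\<^sub>v u) $ k)\<^sup>2 = 0"
      using zero that pos unfolding Lap_energy[OF u]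
      by (subst (asm) sum_nonneg_eq_0_iff) (auto simp: less_imp_le)
    with pos[OF that] show ?thesis by simp
  qed
  then have ends: "u $ fst (ends N k) = u $ snd (ends N k)" if "k < n_edges N" for k
    using that grad_mult_vec[OF graph(1) u that] by simp
  have adjacent: "u $ x = u $ y" if "{x, y} \<in> edges N" for x y
  proof -
    have "{x, y} \<in> edge N ` {0..<n_edges N}"
      using graph(1) that by (simp add: simple_graph_def bij_betw_def)
    then obtain k where k: "k < n_edges N" "edge N k = {x, y}"
      by auto
    from k(2) consider "fst (ends N k) = x" "snd (ends N k) = y" | "fst (ends N k) = y" "snd (ends N k) = x"
      by (auto simp: edge_def doubleton_eq_iff)
    then show ?thesis
      using ends[OF k(1)] by cases simp_all
  qed
  have "(i, j) \<in> {(x, y). {x, y} \<in> edges N}\<^sup>*"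
    using graph(2) assms(6,7) by (simp add: connected_graph_def)
  then show ?thesis
  proof (induction rule: rtrancl_induct)
    case (step y z)
    then show ?case using adjacent[of y z] by simp
  qed simp
qed

section \<open>The Green function as an inverse on interior vertices\<close>

lemma interior_Lap_kernel:
  assumes "simple_graph N" "connected_graph N" "conductivity N"
    and b: "b \<in> verts N" "b \<in> B N"
    and x: "x \<in> carrier_vec (card (interior_verts N))"
    and zero: "submatrix (Lap N (sigma N)) (interior_verts N) (interior_verts N) *\<^sub>v x
      = 0\<^sub>v (card (interior_verts N))"
  shows "x = 0\<^sub>v (card (interior_verts N))"
proof -
  let ?I = "interior_verts N"
  let ?Q = "Res N ?I" and ?k = "card ?I" and ?n = "n_verts N" and ?L = "Lap N (sigma N)"
  have I: "?I \<subseteq> verts N" by (simp add: interior_verts_def)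
  have Q: "?Q \<in> carrier_mat ?k ?n" and QT: "?Q\<^sup>T \<in> carrier_mat ?n ?k" by simp_all
  \<comment> \<open>This extends \<open>x\<close> by zero to \<open>B N\<close>. Its energy is the
    scalar product of \<open>x\<close> with the image of \<open>x\<close> under the interior block,
    hence zero.\<close>
  define u where "u = ?Q\<^sup>T *\<^sub>v x"
  have u: "u \<in> carrier_vec ?n" unfolding u_def using mult_mat_vec_carrier[OF QT x] .
  have Lu: "?L *\<^sub>v u \<in> carrier_vec ?n" using mult_mat_vec_carrier[OF Lap_carrier u] .
  have "?Q *\<^sub>v (?L *\<^sub>v u) = ?Q * ?L * ?Q\<^sup>T *\<^sub>v x"
    unfolding u_def using x u[unfolded u_def]
    by (simp add: assoc_mult_mat_vec[of "?Q * ?L" ?k ?n "?Q\<^sup>T" ?k] assoc_mult_mat_vec[of _ ?k ?n _ ?n]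
        mult_carrier_mat[OF Q])
  also have "\<dots> = 0\<^sub>v ?k"
    using zero by (simp add: submatrix_eq_Res[OF I])
  finally have "u \<bullet> (?L *\<^sub>v u) = 0"
    using transpose_vec_mult_scalar[OF Q Lu x] x by (simp add: u_def)
  then have "u $ i = u $ b" if "i < ?n" for i
    using Lap_energy_zero_imp_constant[OF assms(1-3) u _ _ b(1)] that by (simp add: verts_def)
  moreover have "u $ b = 0"
  proof -
    \<comment> \<open>No interior row selects \<open>b\<close>, so every term of the sum defining
      \<open>u $ b\<close> vanishes.\<close>
    have "pick ?I i \<noteq> b" if "i < ?k" for i
      using pick_in_set_le[OF that] b(2) by (auto simp: interior_verts_def)
    then have "of_bool (b = pick ?I i) * x $ i = 0" if "i < ?k" for i
      using that by auto
    then show ?thesis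
      using b(1) x by (simp add: u_def Res_def scalar_prod_def verts_def)
  qed
  ultimately have "u = 0\<^sub>v ?n"
    using u by (intro eq_vecI) auto
  \<comment> \<open>Restriction undoes the extension by zero, so \<open>u\<close> being zero carries
    over to \<open>x\<close>.\<close>
  moreover have "?Q *\<^sub>v u = x"
    using x by (simp add: u_def assoc_mult_mat_vec[OF Q QT x, symmetric] Res_Res_transpose[OF I])
  moreover have "?Q *\<^sub>v 0\<^sub>v ?n = 0\<^sub>v ?k"
    by (intro eq_vecI) (auto simp: Res_def scalar_prod_def)
  ultimately show ?thesis
    by simp
qed

lemma Green_carrier:
  "Green N \<in> carrier_mat (n_verts N) (n_verts N)"
  unfolding Green_def by (rule carrier_matI) simp_all

text \<open>\<open>Green N\<close> inverts the Laplacian only after compression to the interior, so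
  both identities are tested against \<open>Res N X\<close> for interior \<open>X\<close>.\<close>

lemma Green_Lap:
  assumes "simple_graph N" "connected_graph N" "layered N" "conductivity N"
    and X: "X \<subseteq> interior_verts N"
  shows "Res N X * (Lap N (sigma N) * Green N) = Res N X"
    "Green N * (Lap N (sigma N) * (Res N X)\<^sup>T) = (Res N X)\<^sup>T"
proof -
  let ?I = "interior_verts N"
  let ?A = "submatrix (Lap N (sigma N)) ?I ?I"
  have I: "?I \<subseteq> verts N" by (simp add: interior_verts_def)
  \<comment> \<open>The grounded vertex that excludes nonzero constants from the kernel.\<close>
  obtain b where b: "b \<in> verts N" "b \<in> B N"
    using assms(3) by (auto simp: layered_def)
  note A = submatrix_eq_Res[OF I Lap_carrier[of N "sigma N"]]
  have Ac: "?A \<in> carrier_mat (card ?I) (card ?I)"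
    unfolding A by (rule carrier_matI) simp_all
  define C where "C = the (mat_inverse ?A)"
  have inv: "?A * C = 1\<^sub>m (card ?I)" "C * ?A = 1\<^sub>m (card ?I)" "C \<in> carrier_mat (card ?I) (card ?I)"
    unfolding C_def
    by (rule mat_inverse_of_trivial_kernel[OF Ac]; rule interior_Lap_kernel[OF assms(1,2,4) b]; assumption)+
  have "Green N = (Res N ?I)\<^sup>T * C * Res N ?I"
    by (simp add: Green_def C_def)
  then show "Res N X * (Lap N (sigma N) * Green N) = Res N X"
    "Green N * (Lap N (sigma N) * (Res N X)\<^sup>T) = (Res N X)\<^sup>T"
    using compressed_inverse_mult[OF Res_carrier Res_carrier Lap_carrier inv(3)
        inv(1,2)[unfolded A] Res_mult_proj[OF X I]]
    by simp_all
qed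

section \<open>Jump relations on the boundary\<close>

theorem theorem3p2:
  fixes N :: network
  assumes "simple_graph N" and "connected_graph N" and "layered N"
    and "conductivity N" and "edge_partition_of_unity N"
  shows "gamma1_plus N * single_layer N = - ((1/2) \<cdot>\<^sub>m Id_bd N) + D'_op N
    \<and> gamma1_minus N * single_layer N = (1/2) \<cdot>\<^sub>m Id_bd N + D'_op N
    \<and> gamma0 N * double_layer_plus N = - ((1/2) \<cdot>\<^sub>m Id_bd N) + D_op N
    \<and> gamma0 N * double_layer_minus N = (1/2) \<cdot>\<^sub>m Id_bd N + D_op N
    \<and> gamma1_plus N * double_layer_minus N = gamma1_minus N * double_layer_plus N"
proof -
  let ?m = "card (bd_Omega N)" and ?n = "n_verts N"
  define R where "R = Res N (bd_Omega N)"
  define P where "P = Lap N (sigma_plus N)"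
  define M where "M = Lap N (sigma_minus N)"
  define G where "G = Green N"
  have bd: "bd_Omega N \<subseteq> interior_verts N" "bd_Omega N \<subseteq> verts N"
    using assms(3) by (auto simp: layered_def interior_verts_def)
  have R: "R \<in> carrier_mat ?m ?n" and P: "P \<in> carrier_mat ?n ?n" and M: "M \<in> carrier_mat ?n ?n"
    and G: "G \<in> carrier_mat ?n ?n"
    by (simp_all add: R_def P_def M_def G_def Green_carrier)
  have d [simp]: "dim_row R = ?m" "dim_col R = ?n" "dim_row P = ?n" "dim_col P = ?n"
    "dim_row M = ?n" "dim_col M = ?n" "dim_row G = ?n" "dim_col G = ?n"
    using R P M G by auto
  have RT: "R\<^sup>T \<in> carrier_mat ?n ?m" using R by simp
  have L: "Lap N (sigma N) = P + M"
    unfolding P_def M_def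
    using assms(5) by (intro Lap_add)
      (simp add: edge_partition_of_unity_def sigma_plus_def sigma_minus_def distrib_right[symmetric])
  have left: "R * ((P + M) * G) = R" and right: "G * ((P + M) * R\<^sup>T) = R\<^sup>T"
    using Green_Lap[OF assms(1-4) bd(1)] by (simp_all add: L R_def G_def)
  have RR: "R * R\<^sup>T = 1\<^sub>m ?m"
    unfolding R_def by (rule Res_Res_transpose[OF bd(2)])
  \<comment> \<open>Symmetry of both partial Laplacians enters here.\<close>
  have PT: "(- (R * P))\<^sup>T = - (P * R\<^sup>T)" and MT: "(R * M)\<^sup>T = M * R\<^sup>T"
    using transpose_mult[OF R P] transpose_mult[OF R M]
    by (simp_all add: transpose_uminus P_def M_def Lap_transpose)
  note gammas = gamma1_plus_def[of N, folded R_def P_def] gamma1_minus_def[of N, folded R_def M_def]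
    gamma0_def[of N, folded R_def]
  have S: "single_layer N = G * R\<^sup>T"
    by (simp add: single_layer_def gammas G_def)
  have Dp: "double_layer_plus N = - (G * (P * R\<^sup>T))"
    by (simp add: double_layer_plus_def gammas PT G_def[symmetric])
  have Dm: "double_layer_minus N = G * (M * R\<^sup>T)"
    by (simp add: double_layer_minus_def gammas MT G_def[symmetric])
  note prods = mult_carrier_mat[OF R P] mult_carrier_mat[OF R M] mult_carrier_mat[OF G RT]
    mult_carrier_mat[OF P RT] mult_carrier_mat[OF M RT]
  note prods2 = mult_carrier_mat[OF G prods(4)] mult_carrier_mat[OF G prods(5)]

  \<comment> \<open>The minus sign in \<open>gamma1_plus\<close> turns the differences below into
    sums, in which \<open>P\<close> and \<open>M\<close> recombine to the full Laplacian.\<close>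
  have minus_uminus: "X - (- Y) = X + Y" if "X \<in> carrier_mat ?m ?m" "Y \<in> carrier_mat ?m ?m"
    for X Y :: "real mat"
    using that by (intro eq_matI) auto
  have S_carrier: "gamma1_plus N * single_layer N \<in> carrier_mat ?m ?m"
    "gamma1_minus N * single_layer N \<in> carrier_mat ?m ?m"
    and D_carrier: "gamma0 N * double_layer_plus N \<in> carrier_mat ?m ?m"
    "gamma0 N * double_layer_minus N \<in> carrier_mat ?m ?m"
    by (rule carrier_matI; simp add: gammas S Dp Dm)+
  \<comment> \<open>The difference collapses by \<open>left\<close> to \<open>R * R\<^sup>T\<close>,
    the identity.\<close>
  have "gamma1_minus N * single_layer N - gamma1_plus N * single_layer N
      = (R * M) * (G * R\<^sup>T) + (R * P) * (G * R\<^sup>T)"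
    using minus_uminus[OF mult_carrier_mat[OF prods(2,3)] mult_carrier_mat[OF prods(1,3)]]
    by (simp add: gammas S)
  also have "\<dots> = (R * P + R * M) * (G * R\<^sup>T)"
    unfolding add_mult_distrib_mat[OF prods(1,2,3)]
    by (rule comm_add_mat[OF mult_carrier_mat[OF prods(2,3)] mult_carrier_mat[OF prods(1,3)]])
  also have "\<dots> = (R * (P + M)) * (G * R\<^sup>T)"
    by (simp add: mult_add_distrib_mat[OF R P M])
  also have "\<dots> = R * ((P + M) * G) * R\<^sup>T"
    by (simp add: assoc_mult_mat_dim)
  finally have jump_S: "gamma1_minus N * single_layer N - gamma1_plus N * single_layer N = 1\<^sub>m ?m"
    by (simp add: left RR)
  have D': "D'_op N = (1/2) \<cdot>\<^sub>m (gamma1_plus N * single_layer N + gamma1_minus N * single_layer N)"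
    unfolding D'_op_def gammas S
    by (subst add_mult_distrib_mat[of _ ?m ?n]) (use prods in auto)

  \<comment> \<open>The mirror computation: here \<open>right\<close> absorbs \<open>G\<close> and
    the Laplacian into \<open>R\<^sup>T\<close>.\<close>
  have "gamma0 N * double_layer_minus N - gamma0 N * double_layer_plus N
      = R * (G * (M * R\<^sup>T)) + R * (G * (P * R\<^sup>T))"
    using minus_uminus[OF mult_carrier_mat[OF R prods2(2)] mult_carrier_mat[OF R prods2(1)]]
    by (simp add: gammas Dp Dm)
  also have "\<dots> = R * (G * (P * R\<^sup>T) + G * (M * R\<^sup>T))"
    unfolding mult_add_distrib_mat[OF R prods2]
    by (rule comm_add_mat[OF mult_carrier_mat[OF R prods2(2)] mult_carrier_mat[OF R prods2(1)]])
  also have "\<dots> = R * (G * ((P + M) * R\<^sup>T))"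
    by (simp add: add_mult_distrib_mat[OF P M RT] mult_add_distrib_mat[OF G prods(4,5)])
  finally have jump_D: "gamma0 N * double_layer_minus N - gamma0 N * double_layer_plus N = 1\<^sub>m ?m"
    by (simp add: right RR)
  have D: "D_op N = (1/2) \<cdot>\<^sub>m (gamma0 N * double_layer_plus N + gamma0 N * double_layer_minus N)"
    unfolding D_op_def gammas Dp Dm
    by (subst mult_add_distrib_mat[of _ ?m ?n _ ?m]) (use prods2 R in auto)

  \<comment> \<open>Each side carries exactly one minus sign, from \<open>gamma1_plus\<close>, so
    the sign-free product identity applies.\<close>
  have swap: "gamma1_plus N * double_layer_minus N = gamma1_minus N * double_layer_plus N"
    using commuted_layer_products[OF R P M G left right] by (simp add: gammas Dp Dm)
  show ?thesis
    unfolding Id_bd_def D' D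
    using eq_mean_of_jump[OF S_carrier jump_S] eq_mean_of_jump[OF D_carrier jump_D] swap
    by (intro conjI)
qed

end
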